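(* Let $r,c>0$ and $b\in\mathbb{R}$, and suppose that $e^{-r}\neq e^{-c+bi}$ (that is, it is not the case that both $r=c$ and $b\in 2\pi\mathbb{Z}$). Then $$\prod_{n=-\infty}^{\infty}\frac{(b+2\pi n)^2+(r+c)^2}{(b+2\pi n)^2+(r-c)^2}=\left|\frac{1-e^{-r-c+bi}}{e^{-r}-e^{-c+bi}}\right|^2 .$$ *)

theory Defs
  imports "HOL-Analysis.Analysis"
begin

text \<open>
  Two-sided infinite products: as is usual for bilateral products, the product over the integers
  is said to converge iff its two one-sided halves do, and its value is the product of theirs.
  Convergence of each half is that of \<^const>\<open>has_prod\<close>, so a product whose partial products
  tend to zero without a vanishing factor counts as divergent.
\<close>

definition has_bilateral_prod :: "(int \<Rightarrow> 'a::real_normed_field) \<Rightarrow> 'a \<Rightarrow> bool"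
    (infixr "has'_bilateral'_prod" 80) where
  "f has_bilateral_prod P \<longleftrightarrow>
     (\<exists>p q. (\<lambda>n::nat. f (int n)) has_prod p \<and>
            (\<lambda>n::nat. f (- int (Suc n))) has_prod q \<and> P = p * q)"

end

theory Submission
  imports Defs "HOL-Real_Asymp.Real_Asymp"
begin

text \<open>
  Put \<open>w = b + (r + c) \<i>\<close> and \<open>v = b + (c - r) \<i>\<close>. Each factor of the product is
  \<open>\<bar>w + 2 \<pi> n\<bar>\<^sup>2 / \<bar>v + 2 \<pi> n\<bar>\<^sup>2\<close>, so the product runs over the zeros of
  \<open>sin (w/2)\<close> in the numerator and of \<open>sin (v/2)\<close> in the denominator: pairing the factors for
  \<open>n\<close> and \<open>-n\<close> and applying Euler's product for the sine, its value is
  \<open>\<bar>sin (w/2) / sin (v/2)\<bar>\<^sup>2\<close> (\<open>bilateral_prod_sin_ratio\<close>).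

  A difference of two exponentials is, up to an exponential factor, also a sine
  (\<open>norm_exp_diff\<close>). Applied to the numerator \<open>1 - exp (-r - c + b \<i>)\<close> and to the denominator
  \<open>exp (-r) - exp (-c + b \<i>)\<close> of the right-hand side, it gives the same factor
  \<open>2 exp (-(r + c) / 2)\<close> both times, and the sines at \<open>w/2\<close> and \<open>v/2\<close>.

  Pairing only computes the limit of the symmetric partial products. That the two halves converge
  separately holds because \<open>w\<close> and \<open>v\<close> have the same real part, which makes the factors differ
  from 1 by \<open>O(1/n\<^sup>2)\<close> (\<open>convergent_prod_norm_ratio\<close>).
\<close>

text \<open>
  The common real part \<open>x\<close> is essential: for different real parts the factors would differ from 1
  by a multiple of \<open>1/n\<close>, and neither half would converge.
\<close>

lemma convergent_prod_norm_ratio: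
  fixes x y y' :: real
  assumes nz: "\<And>n::nat. Complex x y' + of_nat n \<noteq> 0"
  shows "convergent_prod (\<lambda>n::nat. (norm ((Complex x y + of_nat n) / (Complex x y' + of_nat n)))\<^sup>2)"
proof -
  have eq: "(norm ((Complex x y + of_nat n) / (Complex x y' + of_nat n)))\<^sup>2 - 1
      = (y\<^sup>2 - y'\<^sup>2) / ((x + real n)\<^sup>2 + y'\<^sup>2)" for n
  proof -
    have "(x + real n)\<^sup>2 + y'\<^sup>2 \<noteq> 0"
      using nz[of n] by (auto simp: complex_eq_iff sum_power2_eq_zero_iff)
    thus ?thesis
      by (simp add: norm_divide power_divide cmod_power2 field_simps)
  qed
  have "(\<lambda>n. norm ((y\<^sup>2 - y'\<^sup>2) / ((x + real n)\<^sup>2 + y'\<^sup>2))) \<in> O(\<lambda>n. inverse (real n ^ 2))"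
    unfolding real_norm_def landau_o.big.abs_in_iff by real_asymp
  moreover have "summable (\<lambda>n. norm (inverse (real n ^ 2)))"
    using inverse_power_summable[of 2, where ?'a = real] by simp
  ultimately have "summable (\<lambda>n. norm ((y\<^sup>2 - y'\<^sup>2) / ((x + real n)\<^sup>2 + y'\<^sup>2)))"
    by (rule summable_comparison_test_bigo[rotated])
  thus ?thesis
    by (intro abs_convergent_prod_imp_convergent_prod summable_imp_abs_convergent_prod)
       (simp add: eq)
qed

text \<open>
  The factor \<open>\<Prod>k=1..n. - of_nat k ^ 2\<close> does not involve \<open>w\<close>, so it cancels from a quotient of
  two such products.
\<close>

lemma prod_shift_symmetric:
  fixes w :: complex
  shows "(\<Prod>k\<le>n. w + of_nat k) * (\<Prod>k<n. w - of_nat (Suc k))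
       = w * (\<Prod>k=1..n. 1 - w\<^sup>2 / of_nat k ^ 2) * (\<Prod>k=1..n. - (of_nat k ^ 2))"
proof (induction n)
  case (Suc n)
  define m :: complex where "m = of_nat (Suc n)"
  have "m \<noteq> 0"
    unfolding m_def using of_nat_neq_0 by blast
  hence *: "(w + m) * (w - m) = (1 - w\<^sup>2 / m\<^sup>2) * (- (m\<^sup>2))"
    by (simp add: field_simps power2_eq_square)
  have "(\<Prod>k\<le>Suc n. w + of_nat k) * (\<Prod>k<Suc n. w - of_nat (Suc k))
      = ((\<Prod>k\<le>n. w + of_nat k) * (\<Prod>k<n. w - of_nat (Suc k))) * ((w + m) * (w - m))"
    unfolding m_def by (simp only: prod.atMost_Suc prod.lessThan_Suc mult_ac)
  also have "\<dots> = w * ((\<Prod>k=1..n. 1 - w\<^sup>2 / of_nat k ^ 2) * (1 - w\<^sup>2 / m\<^sup>2))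
                   * ((\<Prod>k=1..n. - (of_nat k ^ 2)) * (- (m\<^sup>2)))"
    unfolding * Suc.IH by (simp only: mult_ac)
  also have "\<dots> = w * (\<Prod>k=1..Suc n. 1 - w\<^sup>2 / of_nat k ^ 2) * (\<Prod>k=1..Suc n. - (of_nat k ^ 2))"
    unfolding m_def by (simp add: mult_ac)
  finally show ?case .
qed simp

theorem bilateral_prod_sin_ratio:
  fixes x y y' :: real
  defines "z \<equiv> Complex x y" and "u \<equiv> Complex x y'"
  assumes nz: "sin (of_real pi * u) \<noteq> 0"
  shows "(\<lambda>n::int. (norm ((z + of_int n) / (u + of_int n)))\<^sup>2)
           has_bilateral_prod (norm (sin (of_real pi * z) / sin (of_real pi * u)))\<^sup>2"
proof -
  define f where "f = (\<lambda>n::int. (norm ((z + of_int n) / (u + of_int n)))\<^sup>2)"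
  have u: "u + of_int n \<noteq> 0" for n :: int
  proof
    assume "u + of_int n = 0"
    hence "u = of_int (- n)"
      by (simp add: eq_neg_iff_add_eq_0)
    hence "of_real pi * u = of_real (pi * of_int (- n))"
      by simp
    hence "sin (of_real pi * u) = of_real (sin (pi * of_int (- n)))"
      by (simp only: sin_of_real)
    also have "sin (pi * of_int (- n)) = 0"
      by (rule sin_npi_int)
    finally show False
      using nz by simp
  qed

  have "convergent_prod (\<lambda>n. f (int n))"
    using convergent_prod_norm_ratio[of x y' y] u[of "int _"] by (simp add: f_def z_def u_def)
  then obtain p where p: "(\<lambda>n. f (int n)) has_prod p"
    using convergent_prod_imp_has_prod by blast

  \<comment> \<open>Reflection: the negative half for \<open>(x, y, y')\<close> is the positive half for \<open>(1 - x, -y, -y')\<close>.\<close>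
  have refl: "Complex x s + of_int (- int (Suc n)) = - (Complex (1 - x) (- s) + of_nat n)" for s n
    by (simp add: complex_eq_iff)
  have "Complex (1 - x) (- y') + of_nat n \<noteq> 0" for n
    using u[of "- int (Suc n)"] unfolding u_def refl
    by (simp only: neg_equal_0_iff_equal not_False_eq_True)
  from convergent_prod_norm_ratio[OF this, of "- y"]
  have "convergent_prod (\<lambda>n. f (- int (Suc n)))"
    unfolding f_def z_def u_def refl norm_divide norm_minus_cancel .
  then obtain q where q: "(\<lambda>n. f (- int (Suc n))) has_prod q"
    using convergent_prod_imp_has_prod by blast

  define E where "E = (\<lambda>w n. of_real pi * w * (\<Prod>k=1..n. 1 - w\<^sup>2 / of_nat k ^ 2) :: complex)"
  have partial: "(\<Prod>k\<le>n. f (int k)) * (\<Prod>k<n. f (- int (Suc k))) = (norm (E z n / E u n))\<^sup>2" for n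
  proof -
    define D :: complex where "D = (\<Prod>k=1..n. - (of_nat k ^ 2))"
    have D: "D \<noteq> 0"
      by (simp add: D_def)
    define S where "S = (\<lambda>w. (\<Prod>k\<le>n. w + of_nat k) * (\<Prod>k<n. w - of_nat (Suc k)) :: complex)"
    have S: "of_real pi * S w = E w n * D" for w
      unfolding S_def prod_shift_symmetric E_def D_def by simp
    have "(\<Prod>k\<le>n. f (int k)) * (\<Prod>k<n. f (- int (Suc k))) = (norm (S z / S u))\<^sup>2"
      unfolding f_def S_def
      by (simp add: prod_power_distrib prod_norm prod_dividef norm_mult norm_divide
            power_mult_distrib power_divide algebra_simps flip: prod_norm)
    also have "S z / S u = (of_real pi * S z) / (of_real pi * S u)"
      by simp
    also have "\<dots> = E z n / E u n"
      unfolding S using D by simp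
    finally show ?thesis .
  qed
  have "(\<lambda>n. (norm (E z n / E u n))\<^sup>2) \<longlonglongrightarrow> (norm (sin (of_real pi * z) / sin (of_real pi * u)))\<^sup>2"
    unfolding E_def by (intro tendsto_intros sin_product_formula_complex nz)
  moreover have "(\<lambda>n. (norm (E z n / E u n))\<^sup>2) \<longlonglongrightarrow> p * q"
    unfolding partial [symmetric]
    by (intro tendsto_mult has_prod_imp_tendsto[OF p] has_prod_imp_tendsto'[OF q])
  ultimately have "(norm (sin (of_real pi * z) / sin (of_real pi * u)))\<^sup>2 = p * q"
    by (rule LIMSEQ_unique)
  with p q show ?thesis
    unfolding has_bilateral_prod_def f_def by blast
qed

lemma norm_exp_diff:
  fixes s t :: complex
  shows "norm (exp s - exp t) = 2 * exp ((Re s + Re t) / 2) * norm (sin (\<i> * (s - t) / 2))"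
proof -
  define d where "d = (s - t) / 2"
  define m where "m = (s + t) / 2"
  have st: "s = m + d" "t = m - d"
    by (simp_all add: m_def d_def field_simps)
  have "exp s - exp t = exp m * (exp d - exp (- d))"
    unfolding st by (simp add: exp_add exp_diff exp_minus field_simps)
  also have "exp d - exp (- d) = - (2 * \<i> * sin (\<i> * d))"
    by (simp add: sin_exp_eq)
  also have "\<i> * d = \<i> * (s - t) / 2"
    by (simp add: d_def)
  finally show ?thesis
    by (simp add: norm_mult m_def)
qed

theorem mainTheorem3:
  fixes r c b :: real
  assumes "r > 0" and "c > 0"
    and "exp (- complex_of_real r) \<noteq> exp (- complex_of_real c + complex_of_real b * \<i>)"
  shows "(\<lambda>n::int. ((b + 2 * pi * of_int n)\<^sup>2 + (r + c)\<^sup>2) /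
                   ((b + 2 * pi * of_int n)\<^sup>2 + (r - c)\<^sup>2))
         has_bilateral_prod
         (cmod ((1 - exp (- complex_of_real r - complex_of_real c + complex_of_real b * \<i>)) /
                (exp (- complex_of_real r) - exp (- complex_of_real c + complex_of_real b * \<i>))))\<^sup>2"
proof -
  define z where "z = Complex (b / (2 * pi)) ((r + c) / (2 * pi))"
  define u where "u = Complex (b / (2 * pi)) ((c - r) / (2 * pi))"

  have num: "norm (1 - exp (- complex_of_real r - complex_of_real c + complex_of_real b * \<i>))
      = 2 * exp (- (r + c) / 2) * norm (sin (of_real pi * z))"
  proof -
    have "\<i> * (0 - (- complex_of_real r - complex_of_real c + complex_of_real b * \<i>)) / 2
        = of_real pi * z"
      by (simp add: z_def complex_eq_iff)
    thus ?thesis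
      using norm_exp_diff[of 0 "- complex_of_real r - complex_of_real c + complex_of_real b * \<i>"]
      by (simp add: algebra_simps)
  qed
  have den: "norm (exp (- complex_of_real r) - exp (- complex_of_real c + complex_of_real b * \<i>))
      = 2 * exp (- (r + c) / 2) * norm (sin (of_real pi * u))"
  proof -
    have "\<i> * (- complex_of_real r - (- complex_of_real c + complex_of_real b * \<i>)) / 2
        = of_real pi * u"
      by (simp add: u_def complex_eq_iff)
    thus ?thesis
      using norm_exp_diff[of "- complex_of_real r" "- complex_of_real c + complex_of_real b * \<i>"]
      by (simp add: algebra_simps)
  qed
  have nz: "sin (of_real pi * u) \<noteq> 0"
    using den assms(3) by auto

  have sq: "(norm (Complex (b / (2 * pi)) (s / (2 * pi)) + of_int n))\<^sup>2
      = ((b + 2 * pi * of_int n)\<^sup>2 + s\<^sup>2) / (2 * pi)\<^sup>2" for s and n :: int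
    unfolding cmod_power2 by (simp add: field_simps power2_eq_square)
  have factor: "(norm ((z + of_int n) / (u + of_int n)))\<^sup>2
      = ((b + 2 * pi * of_int n)\<^sup>2 + (r + c)\<^sup>2) / ((b + 2 * pi * of_int n)\<^sup>2 + (r - c)\<^sup>2)"
    for n :: int
    unfolding norm_divide power_divide z_def u_def sq by (simp add: power2_commute)
  have "(norm (sin (of_real pi * z) / sin (of_real pi * u)))
      = norm ((1 - exp (- complex_of_real r - complex_of_real c + complex_of_real b * \<i>)) /
              (exp (- complex_of_real r) - exp (- complex_of_real c + complex_of_real b * \<i>)))"
    unfolding norm_divide num den by simp
  with bilateral_prod_sin_ratio[OF nz[unfolded u_def], of "(r + c) / (2 * pi)"]
  show ?thesis
    by (fold z_def u_def) (simp only: factor)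
qed

end
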